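(* Let $(\phi_t)_{t\ge0}$ be a continuous one-parameter semigroup of holomorphic functions in the unit disk $\mathbb{D}$ (not a group of hyperbolic rotations) such that its Koenigs domain $\Omega$ is convex. Then every backward orbit of $(\phi_t)$ is Lipschitz.
   Context: A (continuous one-parameter) semigroup in $\mathbb{D}$ is a family $(\phi_t)_{t\ge0}$ of holomorphic functions $\phi_t:\mathbb{D}\to\mathbb{D}$ such that $\phi_0=\mathrm{id}_{\mathbb{D}}$, $\phi_{t+s}=\phi_t\circ\phi_s$ for all $t,s\ge0$, and $\phi_t\to\phi_0$ locally uniformly as $t\to0^+$; every $\phi_t$ is univalent. If $(\phi_t)$ is not a group of hyperbolic rotations (i.e. rotations about a point of $\mathbb{D}$, including the trivial semigroup), there is a unique $\tau\in\overline{\mathbb{D}}$ (Denjoy-Wolff point) with $\phi_t(z)\to\tau$ as $t\to+\infty$ for all $z\in\mathbb{D}$; $(\phi_t)$ is elliptic if $\tau\in\mathbb{D}$ and non-elliptic if $\tau\in\partial\mathbb{D}$. Koenigs function: if $(\phi_t)$ is elliptic, it is the conformal map $h:\mathbb{D}\to\mathbb{C}$ onto its image (unique up to a multiplicative constant) with $h(\tau)=0$ and $h(\phi_t(z))=e^{-\mu t}h(z)$ for all $t\ge0$, $z\in\mathbb{D}$, where $\mu$, $\mathrm{Re}\,\mu>0$, is the unique complex number with $\phi_t'(\tau)=e^{-\mu t}$ for all $t\ge0$. If $(\phi_t)$ is non-elliptic, it is the conformal map $h:\mathbb{D}\to\mathbb{C}$ onto its image (unique up to an additive constant) with $h(\phi_t(z))=h(z)+t$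 for all $t\ge0$, $z\in\mathbb{D}$. The Koenigs domain is $\Omega=h(\mathbb{D})$. For $z\in\mathbb{D}$, $T_z\in(0,+\infty]$ is the supremum of all $T>0$ such that $z\in\phi_t(\mathbb{D})$ for every $t\in[0,T)$, and the backward orbit of $z$ is $\tilde\gamma_z:[0,T_z)\to\mathbb{D}$, $\tilde\gamma_z(t)=\phi_t^{-1}(z)$. A function $\gamma:I\to\mathbb{C}$ on an interval $I\subset\mathbb{R}$ is Lipschitz if there is $C>0$ with $|\gamma(t)-\gamma(s)|\le C|t-s|$ for all $t,s\in I$. *)

theory Defs
  imports "HOL-Complex_Analysis.Complex_Analysis"
begin

abbreviation unit_disc :: "complex set" where
  "unit_disc \<equiv> ball 0 1"

(* Self-maps of the disc are total functions on the complex plane; their values outside the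
   disc, and the members of the family at negative times, are never used. Locally uniform
   convergence is uniform convergence on compact subsets of the disc. *)
definition holomorphic_semigroup :: "(real \<Rightarrow> complex \<Rightarrow> complex) \<Rightarrow> bool" where
  "holomorphic_semigroup \<phi> \<longleftrightarrow>
     (\<forall>t\<ge>0. \<phi> t holomorphic_on unit_disc \<and> \<phi> t ` unit_disc \<subseteq> unit_disc) \<and>
     (\<forall>z\<in>unit_disc. \<phi> 0 z = z) \<and>
     (\<forall>t\<ge>0. \<forall>s\<ge>0. \<forall>z\<in>unit_disc. \<phi> (t + s) z = \<phi> t (\<phi> s z)) \<and>
     (\<forall>K. compact K \<and> K \<subseteq> unit_disc \<longrightarrow> uniform_limit K \<phi> (\<phi> 0) (at_right 0))"

(* Conjugation by the disc automorphism z |-> (z - p) / (1 - cnj p * z), which moves p to 0,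
   turns a hyperbolic rotation about p into a Euclidean rotation about 0. *)
definition hyperbolic_rotation :: "complex \<Rightarrow> (complex \<Rightarrow> complex) \<Rightarrow> bool" where
  "hyperbolic_rotation p f \<longleftrightarrow>
     (\<exists>\<theta>. \<forall>z\<in>unit_disc. f z \<in> unit_disc \<and>
        Moebius_function 0 p (f z) = cis \<theta> * Moebius_function 0 p z)"

(* Includes the trivial semigroup. *)
definition hyperbolic_rotation_group :: "(real \<Rightarrow> complex \<Rightarrow> complex) \<Rightarrow> bool" where
  "hyperbolic_rotation_group \<phi> \<longleftrightarrow>
     (\<exists>p\<in>unit_disc. \<forall>t\<ge>0. hyperbolic_rotation p (\<phi> t))"

definition denjoy_wolff_point :: "(real \<Rightarrow> complex \<Rightarrow> complex) \<Rightarrow> complex \<Rightarrow> bool" where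
  "denjoy_wolff_point \<phi> \<tau> \<longleftrightarrow>
     \<tau> \<in> cball 0 1 \<and> (\<forall>z\<in>unit_disc. ((\<lambda>t. \<phi> t z) \<longlongrightarrow> \<tau>) at_top)"

(* h is a Koenigs function of the semigroup. The first alternative is the elliptic case, the
   second the non-elliptic one. *)
definition koenigs_function ::
    "(real \<Rightarrow> complex \<Rightarrow> complex) \<Rightarrow> (complex \<Rightarrow> complex) \<Rightarrow> bool" where
  "koenigs_function \<phi> h \<longleftrightarrow>
     h holomorphic_on unit_disc \<and> inj_on h unit_disc \<and>
     (\<exists>\<tau>. denjoy_wolff_point \<phi> \<tau> \<and>
        (\<tau> \<in> unit_disc \<and> h \<tau> = 0 \<and>
           (\<exists>\<mu>. Re \<mu> > 0 \<and>
              (\<forall>t\<ge>0. deriv (\<phi> t) \<tau> = exp (- \<mu> * of_real t)) \<and>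
              (\<forall>t\<ge>0. \<forall>z\<in>unit_disc. h (\<phi> t z) = exp (- \<mu> * of_real t) * h z))
         \<or> \<tau> \<in> sphere 0 1 \<and>
           (\<forall>t\<ge>0. \<forall>z\<in>unit_disc. h (\<phi> t z) = h z + of_real t)))"

(* The time T_z, possibly infinite, up to which the backward orbit of z is defined. *)
definition backward_time :: "(real \<Rightarrow> complex \<Rightarrow> complex) \<Rightarrow> complex \<Rightarrow> ereal" where
  "backward_time \<phi> z =
     (SUP T \<in> {T::real. 0 < T \<and> (\<forall>t\<in>{0..<T}. z \<in> \<phi> t ` unit_disc)}. ereal T)"

definition backward_interval :: "(real \<Rightarrow> complex \<Rightarrow> complex) \<Rightarrow> complex \<Rightarrow> real set" where
  "backward_interval \<phi> z = {t. 0 \<le> t \<and> ereal t < backward_time \<phi> z}"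

(* Meaningful for t in the backward interval; the members of a semigroup are injective on
   the disc, so the preimage is then unique. *)
definition backward_orbit ::
    "(real \<Rightarrow> complex \<Rightarrow> complex) \<Rightarrow> complex \<Rightarrow> real \<Rightarrow> complex" where
  "backward_orbit \<phi> z t = inv_into unit_disc (\<phi> t) z"

end

(* The inverse f of the Koenigs function h satisfies |f'(w)| = O(1 / (1 + |w|)) on the convex
   domain Omega. Indeed, let delta be the distance from w to the complement of Omega. The
   Schwarz-Pick inequality on the disc of radius delta about w gives
   delta |f'(w)| <= 1 - |f(w)|^2, while the Schwarz lemma for h, composed with the Cayley map of
   the half-plane that supports Omega at a point nearest to w, bounds 1 - |f(w)|^2 by a multiple
   of delta / (1 + |w|). The backward orbits are f(h(z) - t) in the non-elliptic and
   f(exp(mu t) h(z)) in the elliptic case, so their speeds are bounded. *)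
theory Submission
  imports Defs
begin

section \<open>Two estimates from the Schwarz lemma\<close>

text \<open>Rescaling to the unit disc and following \<open>f\<close> by the automorphism that sends
  \<open>f w\<close> to 0 gives a self-map fixing 0. The Schwarz lemma bounds its derivative at 0 by
  1, and the chain rule computes that derivative.\<close>

lemma Schwarz_Pick_deriv_centre:
  assumes f: "f holomorphic_on ball w r" and r: "0 < r"
    and lt1: "\<And>x. x \<in> ball w r \<Longrightarrow> norm (f x) < 1"
  shows "r * norm (deriv f w) \<le> 1 - (norm (f w))\<^sup>2"
proof -
  define a where "a = f w"
  have a: "norm a < 1"
    using lt1[of w] r by (simp add: a_def)
  then have a2: "(norm a)\<^sup>2 < 1"
    by (simp add: power_less_one_iff abs_square_less_1)
  define F where "F = Moebius_function 0 a \<circ> (f \<circ> (\<lambda>x. w + of_real r * x))"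
  have sub: "w + of_real r * x \<in> ball w r" if "norm x < 1" for x
    using that r by (simp add: dist_norm norm_mult)
  have F_holo: "F holomorphic_on ball 0 1"
    unfolding F_def
  proof (intro holomorphic_on_compose_gen)
    show "Moebius_function 0 a holomorphic_on ball 0 1"
      by (rule Moebius_function_holomorphic[OF a])
    show "f holomorphic_on ball w r"
      by (rule f)
    show "(\<lambda>x. w + complex_of_real r * x) holomorphic_on ball 0 1"
      by (intro holomorphic_intros)
    show "(\<lambda>x. w + complex_of_real r * x) ` ball 0 1 \<subseteq> ball w r"
      using sub by auto
    show "(f \<circ> (\<lambda>x. w + complex_of_real r * x)) ` ball 0 1 \<subseteq> ball 0 1"
      using sub lt1 by auto
  qed
  have F0: "F 0 = 0"
    by (simp add: F_def a_def Moebius_function_eq_zero)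
  have F_lt1: "norm (F x) < 1" if "norm x < 1" for x
    unfolding F_def using Moebius_function_norm_lt_1[OF a lt1[OF sub[OF that]]] by simp
  have le1: "norm (deriv F 0) \<le> 1"
    by (rule Schwarz_Lemma(2)[OF F_holo F0 F_lt1, of 0]) auto
  \<comment> \<open>The automorphism has derivative \<open>1 / (1 - cnj a * a)\<close> at
    \<open>a\<close>; once the denominator is seen to be a positive real, the norm of the quotient
    can be read off.\<close>
  have ca: "1 - cnj a * a = of_real (1 - (norm a)\<^sup>2)"
    using complex_norm_square[of a] by (simp add: mult.commute)
  have ne: "1 - cnj a * a \<noteq> 0"
    unfolding ca using a2 by (simp del: of_real_diff)
  have M: "(Moebius_function 0 a has_field_derivative 1 / (1 - cnj a * a)) (at a)"
    unfolding Moebius_function_def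
    by (rule derivative_eq_intros refl | use ne in \<open>simp add: divide_simps power2_eq_square\<close>)+
  have df: "(f has_field_derivative deriv f w) (at w)"
    using f r by (auto intro: holomorphic_derivI[OF _ open_ball])
  have "(F has_field_derivative 1 / (1 - cnj a * a) * (deriv f w * of_real r)) (at 0)"
    unfolding F_def
  proof (intro DERIV_chain)
    show "(Moebius_function 0 a has_field_derivative 1 / (1 - cnj a * a))
        (at ((f \<circ> (\<lambda>x. w + complex_of_real r * x)) 0))"
      using M by (simp add: a_def)
    show "(f has_field_derivative deriv f w) (at (w + complex_of_real r * 0))"
      using df by simp
    show "((\<lambda>x. w + complex_of_real r * x) has_field_derivative complex_of_real r) (at 0)"
      by (auto intro!: derivative_eq_intros)
  qed
  then have "deriv F 0 = (deriv f w * of_real r) / of_real (1 - (norm a)\<^sup>2)"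
    unfolding ca by (simp add: DERIV_imp_deriv del: of_real_diff)
  then have "norm (deriv F 0) = norm (deriv f w) * r / (1 - (norm a)\<^sup>2)"
    using a2 r by (simp add: norm_divide norm_mult del: of_real_diff)
  then show ?thesis
    using le1 a2 by (simp add: pos_divide_le_eq a_def mult.commute)
qed

text \<open>The Cayley map \<open>(d - w) / (d + w)\<close> carries the right half-plane into the
  unit disc and \<open>d\<close> to 0, so the Schwarz lemma applies to its composition with
  \<open>P\<close>.\<close>

lemma positive_real_part_lower_bound:
  assumes P: "P holomorphic_on ball 0 1" and P0: "P 0 = of_real d"
    and pos: "\<And>x. norm x < 1 \<Longrightarrow> 0 < Re (P x)" and z: "norm z < 1"
  shows "(1 - (norm z)\<^sup>2) * (d\<^sup>2 + (norm (P z))\<^sup>2) \<le> 4 * d * Re (P z)"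
proof -
  have d: "0 < d"
    using pos[of 0] P0 by simp
  have ne: "of_real d + P x \<noteq> 0" if "norm x < 1" for x
    using pos[OF that] d by (auto simp: complex_eq_iff)
  \<comment> \<open>This identity is used twice: it shows that the Cayley transform has modulus
    below 1, and it turns the squared Schwarz bound at \<open>z\<close> into a lower bound for
    \<open>Re (P z)\<close>.\<close>
  have cayley: "(norm (of_real d + P x))\<^sup>2 = (norm (of_real d - P x))\<^sup>2 + 4 * d * Re (P x)" for x
    unfolding cmod_power2 by (simp add: power2_eq_square algebra_simps)
  define \<sigma> where "\<sigma> = (\<lambda>x. (of_real d - P x) / (of_real d + P x))"
  have "\<sigma> holomorphic_on ball 0 1"
    unfolding \<sigma>_def using ne by (intro holomorphic_intros P) auto
  moreover have "\<sigma> 0 = 0"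
    by (simp add: \<sigma>_def P0)
  moreover have "norm (\<sigma> x) < 1" if "norm x < 1" for x
  proof -
    have "(norm (of_real d - P x))\<^sup>2 < (norm (of_real d + P x))\<^sup>2"
      using cayley[of x] pos[OF that] d by simp
    then have "norm (of_real d - P x) < norm (of_real d + P x)"
      by (rule power_less_imp_less_base) simp
    then show ?thesis
      using ne[OF that] by (simp add: \<sigma>_def norm_divide divide_simps)
  qed
  ultimately have "norm (\<sigma> z) \<le> norm z"
    using z by (rule Schwarz_Lemma(1))
  then have "norm (of_real d - P z) \<le> norm z * norm (of_real d + P z)"
    using ne[OF z] by (simp add: \<sigma>_def norm_divide divide_simps)
  then have "(norm (of_real d - P z))\<^sup>2 \<le> (norm z)\<^sup>2 * (norm (of_real d + P z))\<^sup>2"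
    by (metis norm_ge_zero power_mono power_mult_distrib)
  then have 1: "(1 - (norm z)\<^sup>2) * (norm (of_real d + P z))\<^sup>2 \<le> 4 * d * Re (P z)"
    using cayley[of z] by (simp add: algebra_simps)
  have "d\<^sup>2 + (norm (P z))\<^sup>2 \<le> (norm (of_real d + P z))\<^sup>2"
    using d pos[OF z] unfolding cmod_power2 by (simp add: power2_eq_square algebra_simps)
  moreover have "0 \<le> 1 - (norm z)\<^sup>2"
    using z by (simp add: abs_square_le_1)
  ultimately show ?thesis
    using 1 by (meson mult_left_mono order_trans)
qed

section \<open>Supporting lines and omitted values\<close>

text \<open>Separation alone gives a weak inequality. Since \<open>S\<close> is open, each of its
  points can be pushed a little along the normal without leaving \<open>S\<close>, which makes the
  inequality strict.\<close>

lemma open_convex_supporting_unit_normal: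
  fixes S :: "'a::euclidean_space set"
  assumes "open S" "convex S" "S \<noteq> {}" "p \<notin> S"
  obtains u where "norm u = 1" "\<And>x. x \<in> S \<Longrightarrow> 0 < u \<bullet> (p - x)"
proof -
  obtain a b where a: "a \<noteq> 0" and ab: "\<And>x. x \<in> S \<Longrightarrow> a \<bullet> x \<le> b" "b \<le> a \<bullet> p"
    using separating_hyperplane_sets[of S "{p}"] assms by auto
  have strict: "a \<bullet> x < a \<bullet> p" if x: "x \<in> S" for x
  proof -
    obtain e where e: "e > 0" "cball x e \<subseteq> S"
      using \<open>open S\<close> x open_contains_cball by blast
    have "x + (e / norm a) *\<^sub>R a \<in> S"
      using e a by (intro subsetD[OF e(2)]) (simp add: dist_norm)
    then have "a \<bullet> (x + (e / norm a) *\<^sub>R a) \<le> b"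
      by (rule ab(1))
    then have "a \<bullet> x + e / norm a * (a \<bullet> a) \<le> b"
      by (simp add: inner_add_right)
    moreover have "0 < e / norm a * (a \<bullet> a)"
      using e a by simp
    ultimately show ?thesis
      using ab(2) by linarith
  qed
  show thesis
  proof (rule that[of "a /\<^sub>R norm a"])
    show "norm (a /\<^sub>R norm a) = 1"
      using a by simp
    show "0 < (a /\<^sub>R norm a) \<bullet> (p - x)" if "x \<in> S" for x
      using strict[OF that] a by (simp add: inner_diff_right divide_simps)
  qed
qed

text \<open>Otherwise the inverse would be a bounded entire function, hence constant by Liouville.
  The lemma ensures that the image has a nonempty complement to measure distances to.\<close>

lemma univalent_image_ne_UNIV:
  assumes "h holomorphic_on ball 0 1" "inj_on h (ball 0 1)"
  shows "h ` ball 0 1 \<noteq> (UNIV :: complex set)"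
proof
  assume UNIV: "h ` ball 0 1 = UNIV"
  obtain f where f: "f holomorphic_on h ` ball 0 1" "\<And>z. z \<in> ball 0 1 \<Longrightarrow> f (h z) = z"
    using holomorphic_has_inverse[OF assms(1) open_ball assms(2)] by blast
  have "f x \<in> ball 0 1" for x
  proof -
    have "x \<in> h ` ball 0 1"
      unfolding UNIV by simp
    then obtain z where "z \<in> ball 0 1" "x = h z"
      by blast
    then show ?thesis
      using f(2)[of z] by simp
  qed
  then have "range f \<subseteq> ball 0 1"
    by (rule image_subsetI)
  then have "bounded (range f)"
    by (rule bounded_subset[OF bounded_ball])
  then have "f constant_on UNIV"
    using f(1) unfolding UNIV by (intro Liouville_theorem)
  then have "f (h 0) = f (h (1/2))"
    unfolding constant_on_def by (metis UNIV_I)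
  moreover have "f (h 0) = 0" "f (h (1/2)) = 1/2"
    by (rule f(2), simp add: norm_divide)+
  ultimately show False
    by simp
qed

section \<open>Derivative estimates for convex univalent maps\<close>

text \<open>The distance \<delta> from \<open>h z\<close> to the complement is squeezed:
  Schwarz-Pick for the inverse bounds it above by \<open>1 - (norm z)\<^sup>2\<close> times
  \<open>norm (deriv h z)\<close>, and the supporting half-plane bounds it below by the same factor
  times a tenth of the left-hand side. The factor cancels.\<close>

lemma convex_univalent_deriv_lower_bound:
  assumes h: "h holomorphic_on ball 0 1" and inj: "inj_on h (ball 0 1)"
    and conv: "convex (h ` ball 0 1)"
    and r: "0 < r" "ball (h 0) r \<subseteq> h ` ball 0 1" and z: "norm z < 1"
  shows "r + norm (h z - h 0) \<le> 10 * norm (deriv h z)"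
proof -
  define \<Omega> where "\<Omega> = h ` ball 0 1"
  have op: "open \<Omega>"
    unfolding \<Omega>_def by (rule open_mapping_thm3[OF h open_ball inj])
  have hz: "h z \<in> \<Omega>" and h0: "h 0 \<in> \<Omega>"
    using z by (auto simp: \<Omega>_def)
  obtain f where f: "f holomorphic_on \<Omega>" "\<And>z. z \<in> ball 0 1 \<Longrightarrow> deriv h z * deriv f (h z) = 1"
      "\<And>z. z \<in> ball 0 1 \<Longrightarrow> f (h z) = z"
    unfolding \<Omega>_def using holomorphic_has_inverse[OF h open_ball inj] by blast
  have "closed (- \<Omega>)" "- \<Omega> \<noteq> {}"
    using op univalent_image_ne_UNIV[OF h inj] by (auto simp: \<Omega>_def)
  then obtain p where p: "p \<in> - \<Omega>" "\<And>y. y \<in> - \<Omega> \<Longrightarrow> dist (h z) p \<le> dist (h z) y"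
    using distance_attains_inf by metis
  define \<delta> where "\<delta> = dist (h z) p"
  have \<delta>: "0 < \<delta>"
    using p(1) hz by (auto simp: \<delta>_def)
  have ball: "ball (h z) \<delta> \<subseteq> \<Omega>"
    using p(2) by (fastforce simp: \<delta>_def)
  have "\<delta> * norm (deriv f (h z)) \<le> 1 - (norm (f (h z)))\<^sup>2"
  proof (rule Schwarz_Pick_deriv_centre[OF holomorphic_on_subset[OF f(1) ball] \<delta>])
    fix x assume "x \<in> ball (h z) \<delta>"
    then show "norm (f x) < 1"
      using ball f(3) by (force simp: \<Omega>_def)
  qed
  \<comment> \<open>Multiplying by \<open>norm (deriv h z)\<close> transfers the estimate from the
    inverse to \<open>h\<close>.\<close>
  moreover have "norm (deriv h z) * norm (deriv f (h z)) = 1"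
    using f(2)[of z] z by (simp flip: norm_mult)
  ultimately have Pick: "\<delta> \<le> (1 - (norm z)\<^sup>2) * norm (deriv h z)"
    using f(3)[of z] z mult_right_mono[of "\<delta> * norm (deriv f (h z))" _ "norm (deriv h z)"]
    by (simp add: mult.assoc mult.commute[of "norm (deriv f (h z))"])

  obtain u where u: "norm u = 1" "\<And>x. x \<in> \<Omega> \<Longrightarrow> 0 < u \<bullet> (p - x)"
    using open_convex_supporting_unit_normal[OF op, of p] conv h0 p(1) by (auto simp: \<Omega>_def)
  define d where "d = u \<bullet> (p - h 0)"
  have Re_cnj: "Re (cnj u * x) = u \<bullet> x" for x
    by (simp add: inner_complex_def)
  \<comment> \<open>\<open>Re (P x)\<close> is the distance from \<open>h x\<close> to the
    supporting line through \<open>p\<close>; the imaginary part is normalised so that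
    \<open>P 0\<close> is the real number \<open>d\<close>.\<close>
  define P where "P = (\<lambda>x. of_real d - cnj u * (h x - h 0))"
  have Re_P: "Re (P x) = u \<bullet> (p - h x)" for x
    by (simp add: P_def Re_cnj d_def inner_diff_right del: times_complex.sel)
  have "(1 - (norm z)\<^sup>2) * (d\<^sup>2 + (norm (P z))\<^sup>2) \<le> 4 * d * Re (P z)"
  proof (rule positive_real_part_lower_bound)
    show "P holomorphic_on ball 0 1"
      unfolding P_def by (intro holomorphic_intros h)
    show "0 < Re (P x)" if "norm x < 1" for x
      unfolding Re_P using that by (intro u(2)) (simp add: \<Omega>_def)
  qed (simp_all add: P_def z)
  moreover have d: "0 < d"
    using u(2)[OF h0] by (simp add: d_def)
  moreover have "Re (P z) \<le> \<delta>"
    unfolding Re_P \<delta>_def using norm_cauchy_schwarz[of u "p - h z"] u(1)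
    by (simp add: dist_norm norm_minus_commute)
  ultimately have supp: "(1 - (norm z)\<^sup>2) * (d\<^sup>2 + (norm (P z))\<^sup>2) \<le> 4 * d * \<delta>"
    by (meson mult_left_mono mult_pos_pos less_imp_le order_trans zero_less_numeral)
  \<comment> \<open>Points of the ball about \<open>h 0\<close> in direction \<open>u\<close> stay
    on the same side of the supporting line. The ball is open, so this is tested for
    \<open>s < r\<close> and passed to the limit.\<close>
  have "r \<le> d"
  proof (rule dense_le_bounded[OF r(1)])
    fix s assume s: "0 < s" "s < r"
    have "h 0 + s *\<^sub>R u \<in> \<Omega>"
      using r(2) s u(1) by (auto simp: \<Omega>_def dist_norm)
    then have "0 < u \<bullet> (p - (h 0 + s *\<^sub>R u))"
      by (rule u(2))
    also have "u \<bullet> (p - (h 0 + s *\<^sub>R u)) = d - s * (u \<bullet> u)"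
      by (simp add: d_def inner_diff_right inner_add_right)
    also have "u \<bullet> u = 1"
      using u(1) by (simp add: dot_square_norm)
    finally show "s \<le> d"
      by simp
  qed
  moreover have "norm (h z - h 0) \<le> d + norm (P z)"
  proof -
    have "norm (h z - h 0) = norm (of_real d - P z)"
      using u(1) by (simp add: P_def norm_mult)
    also have "\<dots> \<le> d + norm (P z)"
      using norm_triangle_ineq4[of "of_real d" "P z"] d by simp
    finally show ?thesis .
  qed
  ultimately have "r + norm (h z - h 0) \<le> 2 * d + norm (P z)"
    by linarith
  \<comment> \<open>The factor \<open>2 * d\<close> lets the mixed term be absorbed by the
    inequality between a product and a sum of squares, leaving a multiple of the quantity bounded in
    \<open>supp\<close>.\<close>
  then have "2 * d * (r + norm (h z - h 0)) \<le> 2 * d * (2 * d + norm (P z))"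
    using d by simp
  also have "\<dots> = 4 * d\<^sup>2 + 2 * d * norm (P z)"
    by (simp add: power2_eq_square algebra_simps)
  also have "\<dots> \<le> 5 * d\<^sup>2 + (norm (P z))\<^sup>2"
    using sum_squares_bound[of d "norm (P z)"] by linarith
  also have "\<dots> \<le> 5 * (d\<^sup>2 + (norm (P z))\<^sup>2)"
    by (simp add: distrib_left)
  finally have geo: "2 * d * (r + norm (h z - h 0)) \<le> 5 * (d\<^sup>2 + (norm (P z))\<^sup>2)" .
  define q where "q = 1 - (norm z)\<^sup>2"
  have q: "0 < q"
    using z by (simp add: q_def abs_square_less_1)
  have "(2 * d * q) * (r + norm (h z - h 0)) \<le> 5 * (q * (d\<^sup>2 + (norm (P z))\<^sup>2))"
    using mult_left_mono[OF geo, of q] q by (simp add: mult_ac)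
  \<comment> \<open>First \<open>supp\<close>, then \<open>Pick\<close>. The constant 10 arises from
    \<open>5 * (4 * d) = (2 * d) * 10\<close>.\<close>
  also have "\<dots> \<le> 5 * (4 * d * (q * norm (deriv h z)))"
    using supp Pick d unfolding q_def[symmetric]
    by (meson mult_left_mono mult_pos_pos less_imp_le order_trans zero_less_numeral)
  finally have "(2 * d * q) * (r + norm (h z - h 0)) \<le> (2 * d * q) * (10 * norm (deriv h z))"
    by (simp add: mult_ac)
  then show ?thesis
    using d q by simp
qed

lemma convex_univalent_inverse_deriv_bound:
  assumes h: "h holomorphic_on ball 0 1" and inj: "inj_on h (ball 0 1)"
    and conv: "convex (h ` ball 0 1)"
  obtains f C where "f holomorphic_on h ` ball 0 1" "\<And>z. z \<in> ball 0 1 \<Longrightarrow> f (h z) = z"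
    "0 < C" "\<And>w. w \<in> h ` ball 0 1 \<Longrightarrow> (1 + norm w) * norm (deriv f w) \<le> C"
proof -
  obtain f where f: "f holomorphic_on h ` ball 0 1"
      "\<And>z. z \<in> ball 0 1 \<Longrightarrow> deriv h z * deriv f (h z) = 1"
      "\<And>z. z \<in> ball 0 1 \<Longrightarrow> f (h z) = z"
    using holomorphic_has_inverse[OF h open_ball inj] by blast
  have "open (h ` ball 0 1)"
    by (rule open_mapping_thm3[OF h open_ball inj])
  then obtain r where r: "0 < r" "ball (h 0) r \<subseteq> h ` ball 0 1"
    by (meson centre_in_ball imageI open_contains_ball zero_less_one)
  \<comment> \<open>Chosen so that \<open>K * r\<close> exceeds \<open>1 + norm (h 0)\<close>, while
    \<open>K \<ge> 1\<close> takes care of \<open>norm (h z - h 0)\<close>.\<close>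
  define K where "K = 1 + (1 + norm (h 0)) / r"
  have K: "0 < K"
    using r(1) by (simp add: K_def add_pos_nonneg)
  have bound: "(1 + norm (h z)) * norm (deriv f (h z)) \<le> 10 * K" if z: "z \<in> ball 0 1" for z
  proof -
    have "1 + norm (h z) \<le> (1 + norm (h 0)) + norm (h z - h 0)"
      using norm_triangle_sub[of "h z" "h 0"] by simp
    also have "\<dots> \<le> K * (r + norm (h z - h 0))"
      using r(1) by (simp add: K_def field_simps)
    also have "\<dots> \<le> K * (10 * norm (deriv h z))"
      using convex_univalent_deriv_lower_bound[OF h inj conv r, of z] z K by simp
    finally have "(1 + norm (h z)) * norm (deriv f (h z))
        \<le> K * (10 * norm (deriv h z)) * norm (deriv f (h z))"
      by (rule mult_right_mono) simp
    also have "\<dots> = 10 * K"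
      using f(2)[OF z] by (simp add: mult.assoc flip: norm_mult)
    finally show ?thesis .
  qed
  show thesis
    by (rule that[OF f(1,3), of "10 * K"]) (use K bound in auto)
qed

section \<open>Backward orbits and their speed\<close>

lemma convex_backward_interval: "convex (backward_interval \<phi> z)"
proof -
  have "is_interval (backward_interval \<phi> z)"
    unfolding is_interval_1 backward_interval_def
    by (auto elim: order_le_less_trans[rotated])
  then show ?thesis
    by (simp add: is_interval_convex_1)
qed

lemma backward_interval_imp_mem_image:
  assumes "t \<in> backward_interval \<phi> z"
  shows "z \<in> \<phi> t ` unit_disc"
proof -
  have "ereal t < (SUP T \<in> {T. 0 < T \<and> (\<forall>t\<in>{0..<T}. z \<in> \<phi> t ` unit_disc)}. ereal T)" "0 \<le> t"
    using assms by (auto simp: backward_interval_def backward_time_def)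
  \<comment> \<open>Being strictly below the supremum, \<open>t\<close> lies in
    \<open>{0..<T}\<close> for some admissible \<open>T\<close>.\<close>
  then show ?thesis
    by (auto simp: less_SUP_iff)
qed

lemma backward_orbit_eq:
  assumes "t \<in> backward_interval \<phi> z"
  shows "backward_orbit \<phi> z t \<in> unit_disc" "\<phi> t (backward_orbit \<phi> z t) = z"
  unfolding backward_orbit_def
  using backward_interval_imp_mem_image[OF assms] by (rule inv_into_into, rule f_inv_into_f)

lemma bounded_vector_derivative_imp_lipschitz_on:
  fixes f :: "real \<Rightarrow> 'a::real_normed_vector"
  assumes "\<And>t. t \<in> S \<Longrightarrow> (f has_vector_derivative f' t) (at t within S)"
    and "convex S" "\<And>t. t \<in> S \<Longrightarrow> norm (f' t) \<le> C" "0 \<le> C"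
  shows "C-lipschitz_on S f"
proof (rule bounded_derivative_imp_lipschitz)
  show "(f has_derivative (\<lambda>x. x *\<^sub>R f' t)) (at t within S)" if "t \<in> S" for t
    using assms(1)[OF that] by (simp add: has_vector_derivative_def)
  show "onorm (\<lambda>x. x *\<^sub>R f' t) \<le> C" if "t \<in> S" for t
    using assms(3)[OF that] by (intro onorm_le) (simp add: mult.commute[of C] mult_left_mono)
qed (use assms in auto)

theorem corollary1p5:
  fixes \<phi> :: "real \<Rightarrow> complex \<Rightarrow> complex" and h :: "complex \<Rightarrow> complex"
  assumes "holomorphic_semigroup \<phi>"
    and "\<not> hyperbolic_rotation_group \<phi>"
    and "koenigs_function \<phi> h"
    and "convex (h ` unit_disc)"
  shows "\<forall>z\<in>unit_disc. \<exists>C>0. C-lipschitz_on (backward_interval \<phi> z) (backward_orbit \<phi> z)"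
proof
  fix z assume z: "z \<in> unit_disc"
  let ?I = "backward_interval \<phi> z" and ?\<gamma> = "backward_orbit \<phi> z" and ?\<Omega> = "h ` unit_disc"
  have h: "h holomorphic_on unit_disc" "inj_on h unit_disc"
    using assms(3) by (auto simp: koenigs_function_def)
  have op: "open ?\<Omega>"
    by (rule open_mapping_thm3[OF h(1) open_ball h(2)])
  obtain f C where f: "f holomorphic_on ?\<Omega>" "\<And>z. z \<in> unit_disc \<Longrightarrow> f (h z) = z"
    and C: "0 < C" "\<And>w. w \<in> ?\<Omega> \<Longrightarrow> (1 + norm w) * norm (deriv f w) \<le> C"
    using convex_univalent_inverse_deriv_bound[OF h assms(4)] by blast
  \<comment> \<open>Common to both cases: the orbit is the image under \<open>f\<close> of a path
    \<open>g\<close> in the Koenigs domain. If the speed of \<open>g\<close> grows at most linearly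
    in \<open>norm (g t)\<close>, the decay of \<open>deriv f\<close> compensates for it.\<close>
  have lip: "\<exists>C>0. C-lipschitz_on ?I ?\<gamma>"
    if g: "\<And>t. t \<in> ?I \<Longrightarrow> h (?\<gamma> t) = g t" "\<And>t. (g has_vector_derivative g' t) (at t)"
      and K: "0 < K" "\<And>t. norm (g' t) \<le> K * (1 + norm (g t))" for g g' :: "real \<Rightarrow> complex" and K
  proof (intro exI conjI)
    show "0 < K * C"
      using K C by simp
    have g_mem: "g t \<in> ?\<Omega>" if "t \<in> ?I" for t
      using g(1)[OF that] backward_orbit_eq(1)[OF that] by (metis imageI)
    have "(K * C)-lipschitz_on ?I (f \<circ> g)"
    proof (rule bounded_vector_derivative_imp_lipschitz_on)
      fix t assume t: "t \<in> ?I"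
      have "(f has_field_derivative deriv f (g t)) (at (g t))"
        by (rule holomorphic_derivI[OF f(1) op g_mem[OF t]])
      then show "(f \<circ> g has_vector_derivative g' t * deriv f (g t)) (at t within ?I)"
        using field_vector_diff_chain_at[OF g(2)] has_vector_derivative_at_within by blast
      have "norm (g' t * deriv f (g t)) \<le> K * (1 + norm (g t)) * norm (deriv f (g t))"
        using K(2)[of t] by (simp add: norm_mult mult_right_mono)
      also have "\<dots> \<le> K * C"
        using C(2)[OF g_mem[OF t]] K(1) by (simp add: mult.assoc)
      finally show "norm (g' t * deriv f (g t)) \<le> K * C" .
    qed (use K C convex_backward_interval in auto)
    moreover have "(f \<circ> g) t = ?\<gamma> t" if "t \<in> ?I" for t
      using g(1)[OF that] f(2)[OF backward_orbit_eq(1)[OF that]] by simp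
    ultimately show "(K * C)-lipschitz_on ?I ?\<gamma>"
      by (metis lipschitz_on_cong)
  qed
  consider (elliptic) \<mu> where "Re \<mu> > 0"
      "\<And>t z. t \<ge> 0 \<Longrightarrow> z \<in> unit_disc \<Longrightarrow> h (\<phi> t z) = exp (- \<mu> * of_real t) * h z"
    | (non_elliptic) "\<And>t z. t \<ge> 0 \<Longrightarrow> z \<in> unit_disc \<Longrightarrow> h (\<phi> t z) = h z + of_real t"
    using assms(3) unfolding koenigs_function_def by blast
  then show "\<exists>C>0. C-lipschitz_on ?I ?\<gamma>"
  proof cases
    case elliptic
    show ?thesis
    \<comment> \<open>The path comes from solving the functional equation at
      \<open>?\<gamma> t\<close>, which \<phi> at time \<open>t\<close> maps to \<open>z\<close>.
      Its speed is \<open>norm \<mu>\<close> times its modulus, and \<open>Re \<mu> > 0\<close>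
      makes this factor positive.\<close>
    proof (rule lip[of "\<lambda>t. exp (\<mu> * of_real t) * h z" "\<lambda>t. \<mu> * exp (\<mu> * of_real t) * h z" "norm \<mu>"])
      fix t assume t: "t \<in> ?I"
      then have "h z = exp (- \<mu> * of_real t) * h (?\<gamma> t)"
        using elliptic(2)[of t "?\<gamma> t"] backward_orbit_eq[OF t] by (simp add: backward_interval_def)
      then show "h (?\<gamma> t) = exp (\<mu> * of_real t) * h z"
        by (simp add: exp_minus field_simps)
    next
      show "((\<lambda>t. exp (\<mu> * of_real t) * h z) has_vector_derivative \<mu> * exp (\<mu> * of_real t) * h z) (at t)"
        for t
        by (rule has_vector_derivative_real_field) (auto intro!: derivative_eq_intros)
    next
      show "norm (\<mu> * exp (\<mu> * of_real t) * h z) \<le> norm \<mu> * (1 + norm (exp (\<mu> * of_real t) * h z))"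
        for t
        by (simp add: norm_mult algebra_simps)
    qed (use elliptic(1) in auto)
  next
    case non_elliptic
    show ?thesis
    \<comment> \<open>Here the path is a horizontal translation to the left at unit speed.\<close>
    proof (rule lip[of "\<lambda>t. h z - of_real t" "\<lambda>_. -1" 1])
      fix t assume t: "t \<in> ?I"
      then show "h (?\<gamma> t) = h z - of_real t"
        using non_elliptic[of t "?\<gamma> t"] backward_orbit_eq[OF t] by (simp add: backward_interval_def)
    next
      show "((\<lambda>t. h z - of_real t) has_vector_derivative -1) (at t)" for t
        by (rule has_vector_derivative_real_field) (auto intro!: derivative_eq_intros)
    qed auto
  qed
qed

end
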